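(* Let $X$ and $Y$ be random variables with distributions $F$ and $G$ respectively, where $F$ has as support the whole real axis and $G(0-)=0$, $G(0)<1$. Let $H$ be the distribution of $XY$. Suppose that (A) for any $c>0$, $\overline{G}(cx)=o[\overline{H}(x)]$ as $x\to\infty$; (B) there exists a function $h:[0,\infty)\to(0,\infty)$ such that $\mathbf{P}[X>x\mid Y=y]\sim h(y)\,\mathbf{P}[X>x]$ as $x\to\infty$, uniformly for $y\in S_Y$. If $F\in\mathcal{T}$, then $H\in\mathcal{T}$.
   Context: For a distribution $F$ write $\overline{F}:=1-F$; throughout $\overline{F}(x)>0$ for all $x\ge 0$. $H(x):=\mathbf{P}[XY\le x]$. $S_Y$ is the support of $Y$. Uniformity in (B) means $\lim_{x\to\infty}\sup_{y\in S_Y}\left|\frac{\mathbf{P}[X>x\mid Y=y]}{h(y)\mathbf{P}[X>x]}-1\right|=0$. $F\in\mathcal{L}$ (long tailed) if for all (equivalently, for some) $a>0$, $\lim_{x\to\infty}\overline{F}(x-a)/\overline{F}(x)=1$. $F\in\mathcal{P_D}$ (positively decreasing) if for all (equivalently, for some) $v>1$, $\limsup_{x\to\infty}\overline{F}(vx)/\overline{F}(x)<1$. $\mathcal{T}:=\mathcal{L}\cap\mathcal{P_D}$ (long tailed positively decreasing distributions). *)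

theory Defs
  imports "HOL-Probability.Probability" "HOL-Library.Landau_Symbols"
begin

text \<open>Distributions on the real line are measures \<open>\<mu>\<close> with \<^prop>\<open>real_distribution \<mu>\<close>;
  their distribution functions are \<^term>\<open>cdf \<mu>\<close>.\<close>

definition tail :: "real measure \<Rightarrow> real \<Rightarrow> real" where
  "tail \<mu> x = 1 - cdf \<mu> x"

definition distr_support :: "real measure \<Rightarrow> real set" where
  "distr_support \<mu> = {y. \<forall>U. open U \<and> y \<in> U \<longrightarrow> measure \<mu> U > 0}"

text \<open>The standing assumption that tails are positive on \<open>[0,\<infinity>)\<close> is part of both classes.\<close>

definition long_tailed :: "real measure set" where
  "long_tailed = {\<mu>. real_distribution \<mu> \<and> (\<forall>x\<ge>0. tail \<mu> x > 0) \<and>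
     (\<forall>a>0. ((\<lambda>x. tail \<mu> (x - a) / tail \<mu> x) \<longlongrightarrow> 1) at_top)}"

definition positively_decreasing :: "real measure set" where
  "positively_decreasing = {\<mu>. real_distribution \<mu> \<and> (\<forall>x\<ge>0. tail \<mu> x > 0) \<and>
     (\<forall>v>1. Limsup at_top (\<lambda>x. ereal (tail \<mu> (v * x) / tail \<mu> x)) < 1)}"

definition class_T :: "real measure set" where
  "class_T = long_tailed \<inter> positively_decreasing"

text \<open>\<open>\<kappa>\<close> is a regular version of the conditional distribution of \<open>X\<close> given \<open>Y\<close>:
  \<open>\<kappa> y A\<close> stands for \<open>P[X \<in> A | Y = y]\<close>, so \<open>\<kappa> (Y \<omega>) A\<close> is a version of the conditional
  expectation of the indicator of \<open>X \<in> A\<close> with respect to the sigma-algebra generated by \<open>Y\<close>.\<close>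

definition regular_cond_distr ::
    "'a measure \<Rightarrow> ('a \<Rightarrow> real) \<Rightarrow> ('a \<Rightarrow> real) \<Rightarrow> (real \<Rightarrow> real measure) \<Rightarrow> bool" where
  "regular_cond_distr M X Y \<kappa> \<longleftrightarrow>
     \<kappa> \<in> borel \<rightarrow>\<^sub>M prob_algebra borel \<and>
     (\<forall>A\<in>sets borel. AE \<omega> in M.
        real_cond_exp M (vimage_algebra (space M) Y borel) (\<lambda>\<omega>. indicator A (X \<omega>)) \<omega>
          = measure (\<kappa> (Y \<omega>)) A)"

end

theory Submission imports Defs begin

text \<open>
  Write \<open>F\<close>, \<open>G\<close>, \<open>H\<close> for the laws of \<open>X\<close>, \<open>Y\<close>, \<open>X Y\<close>. Conditioning on
  \<open>Y = y > 0\<close> turns \<open>X Y > x\<close> into \<open>X > x/y\<close>, whose conditional probability behaves like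
  \<open>h(y)\<close> times the tail of \<open>F\<close> at \<open>x/y\<close>. If \<open>y \<le> c x\<close> with \<open>c\<close> small, then \<open>x/y \<ge> 1/c\<close> is large, so
  asymptotic inequalities between tails of \<open>F\<close> apply at \<open>x/y\<close>, uniformly in \<open>y\<close>, and survive
  integration over \<open>y\<close>. The remaining event \<open>Y > c x\<close> is negligible by (A).

  For positive decrease this is all: if \<open>F\<close> satisfies \<open>tail F (v s) \<le> q tail F s\<close> with \<open>q < 1\<close>
  for large \<open>s\<close>, then \<open>H\<close> inherits such a bound with a larger constant that is still below \<open>1\<close>.

  For the long tail the shift \<open>a\<close> of \<open>x\<close> becomes a shift \<open>a/y\<close> of \<open>x/y\<close>, which is bounded
  only if \<open>y\<close> stays away from \<open>0\<close>; this is where positive decrease of \<open>F\<close> enters. On \<open>Y \<le> \<delta>\<close>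
  the event \<open>X Y > x - a\<close> forces \<open>X > (x - a)/\<delta>\<close>, whereas the tail of \<open>H\<close> at \<open>x\<close> is at least
  a constant times \<open>tail F (x/d)\<close> for a fixed \<open>d > 0\<close> (lemma \<open>tail_product_lower_bound\<close>).
  Iterating the positive decrease of \<open>F\<close> makes the former an arbitrarily small fraction of the
  latter once \<open>\<delta>\<close> is small compared with \<open>d\<close> (lemma \<open>small_factor_negligible\<close>). On
  \<open>\<delta> < Y \<le> c x\<close> the shift is at most \<open>a/\<delta>\<close>, and the long tail of \<open>F\<close> suffices.

  The function \<open>h\<close> need not be measurable, so it is never integrated: it cancels in the
  comparison of two conditional tails at the same \<open>y\<close> (lemma
  \<open>tail_comparison_of_uniform_equivalence\<close>), and only measures of sections of plane sets are
  integrated.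
\<close>

section \<open>Supports and tails of distributions\<close>

text \<open>The complement of the support is a union of open null sets. The line is second countable, so
  countably many of them already cover it, and their union is null.\<close>

lemma AE_distr_support:
  assumes "finite_measure \<mu>" and sets_mu: "sets \<mu> = sets borel"
  shows "AE y in \<mu>. y \<in> distr_support \<mu>"
proof -
  interpret finite_measure \<mu> by fact
  define \<F> where "\<F> = {U :: real set. open U \<and> measure \<mu> U = 0}"
  obtain \<F>' where sub: "\<F>' \<subseteq> \<F>" and "countable \<F>'" and un: "\<Union>\<F>' = \<Union>\<F>"
    using Lindelof[of \<F>] by (auto simp: \<F>_def)
  have "AE y in \<mu>. \<forall>U\<in>\<F>'. y \<notin> U"
  proof (subst AE_ball_countable[OF \<open>countable \<F>'\<close>], intro ballI)
    fix U assume "U \<in> \<F>'"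
    with sub have "open U" "measure \<mu> U = 0" by (auto simp: \<F>_def)
    then have "U \<in> null_sets \<mu>" by (auto simp: null_sets_def sets_mu emeasure_eq_measure)
    then show "AE y in \<mu>. y \<notin> U" by (rule AE_not_in)
  qed
  moreover have "y \<in> distr_support \<mu>" if "\<forall>U\<in>\<F>'. y \<notin> U" for y
  proof -
    have "y \<notin> \<Union>\<F>" using that un by blast
    then show ?thesis
      by (auto simp: distr_support_def \<F>_def zero_less_measure_iff measure_le_0_iff)
  qed
  ultimately show ?thesis by auto
qed

lemma (in prob_space) tail_distr:
  assumes [measurable]: "Z \<in> borel_measurable M"
  shows "tail (distr M borel Z) x = prob {\<omega>\<in>space M. x < Z \<omega>}"
proof -
  have "cdf (distr M borel Z) x = prob {\<omega>\<in>space M. Z \<omega> \<le> x}"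
    by (auto simp: cdf_def measure_distr intro!: arg_cong[where f=prob])
  moreover have "{\<omega>\<in>space M. x < Z \<omega>} = space M - {\<omega>\<in>space M. Z \<omega> \<le> x}" by auto
  ultimately show ?thesis by (simp add: tail_def prob_compl)
qed

lemma (in prob_space) AE_nonneg_of_cdf_at_left_0:
  assumes [measurable]: "Y \<in> borel_measurable M"
    and lim: "(cdf (distr M borel Y) \<longlongrightarrow> 0) (at_left 0)"
  shows "AE \<omega> in M. 0 \<le> Y \<omega>"
proof -
  interpret G: real_distribution "distr M borel Y" by simp
  have "(cdf (distr M borel Y) \<longlongrightarrow> measure (distr M borel Y) {..<0}) (at_left 0)"
    by (rule G.cdf_at_left)
  with lim have "measure (distr M borel Y) {..<0} = 0"
    by (metis tendsto_unique trivial_limit_at_left_real)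
  then have "prob {\<omega>\<in>space M. Y \<omega> < 0} = 0"
    by (simp add: measure_distr vimage_def Int_def conj_commute)
  then have "AE \<omega> in M. \<not> Y \<omega> < 0"
    by (subst (asm) prob_eq_0) auto
  then show ?thesis by (auto simp: not_less)
qed

lemma positively_decreasingD:
  assumes "F \<in> positively_decreasing" "v > 1"
  obtains q s\<^sub>0 where "0 < q" "q < 1" "s\<^sub>0 > 0" "\<And>s. s \<ge> s\<^sub>0 \<Longrightarrow> tail F (v * s) \<le> q * tail F s"
proof -
  have pos: "\<And>x. x \<ge> 0 \<Longrightarrow> tail F x > 0"
    and "Limsup at_top (\<lambda>x. ereal (tail F (v * x) / tail F x)) < 1"
    using assms by (auto simp: positively_decreasing_def)
  then obtain z where z: "Limsup at_top (\<lambda>x. ereal (tail F (v * x) / tail F x)) < ereal z" "ereal z < 1"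
    using ereal_dense2 by blast
  from Limsup_lessD[OF z(1)] obtain s\<^sub>1 where
    s1: "\<And>s. s \<ge> s\<^sub>1 \<Longrightarrow> tail F (v * s) / tail F s < z"
    by (auto simp: eventually_at_top_linorder)
  show ?thesis
  proof
    \<comment> \<open>Taking the maximum with a number in \<open>(0,1)\<close> gives a bound that is visibly positive.\<close>
    show "0 < max z (1/2)" "max z (1/2) < 1" "max s\<^sub>1 1 > 0" using z(2) by auto
    fix s assume s: "s \<ge> max s\<^sub>1 1"
    then have "tail F (v * s) / tail F s < max z (1/2)" using s1[of s] by auto
    then show "tail F (v * s) \<le> max z (1/2) * tail F s" using pos[of s] s
      by (simp add: divide_simps split: if_splits)
  qed
qed

text \<open>Iterating the bound for \<open>v = 2\<close> shows that the tail at a sufficiently large multiple of \<open>s\<close> is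
  an arbitrarily small fraction of the tail at \<open>s\<close>.\<close>

lemma positively_decreasing_power:
  assumes F: "F \<in> positively_decreasing" and "\<epsilon> > 0"
  obtains n :: nat and s\<^sub>0 where "\<And>s. s \<ge> s\<^sub>0 \<Longrightarrow> tail F (2 ^ n * s) \<le> \<epsilon> * tail F s"
proof -
  obtain q s\<^sub>0 where q: "0 < q" "q < 1" "s\<^sub>0 > 0"
    "\<And>s. s \<ge> s\<^sub>0 \<Longrightarrow> tail F (2 * s) \<le> q * tail F s"
    using positively_decreasingD[OF F, of 2] by auto
  have iter: "tail F (2 ^ n * s) \<le> q ^ n * tail F s" if "s \<ge> s\<^sub>0" for n s
  proof (induction n)
    case (Suc n)
    have "1 * s\<^sub>0 \<le> 2 ^ n * s" using that q(3) by (intro mult_mono) auto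
    then have "tail F (2 ^ Suc n * s) \<le> q * tail F (2 ^ n * s)"
      using q(4)[of "2 ^ n * s"] by (simp add: mult.assoc)
    also have "\<dots> \<le> q * (q ^ n * tail F s)" using Suc q by (intro mult_left_mono) auto
    finally show ?case by simp
  qed simp
  obtain n where n: "q ^ n < \<epsilon>" using real_arch_pow_inv \<open>\<epsilon> > 0\<close> q(2) by blast
  show ?thesis
  proof
    fix s assume s: "s \<ge> max s\<^sub>0 0"
    have "tail F s > 0" using F s by (auto simp: positively_decreasing_def)
    then have "q ^ n * tail F s \<le> \<epsilon> * tail F s" using n by (intro mult_right_mono) auto
    then show "tail F (2 ^ n * s) \<le> \<epsilon> * tail F s" using iter[of s n] s by simp
  qed
qed

section \<open>Disintegration along the conditional distribution\<close>

locale conditioned_pair = prob_space M for M :: "'a measure" +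
  fixes X Y :: "'a \<Rightarrow> real" and \<kappa> :: "real \<Rightarrow> real measure"
  assumes X[measurable]: "X \<in> borel_measurable M"
    and Y[measurable]: "Y \<in> borel_measurable M"
    and regular: "regular_cond_distr M X Y \<kappa>"
begin

lemma kernel_measurable[measurable]: "\<kappa> \<in> borel \<rightarrow>\<^sub>M subprob_algebra borel"
  using regular by (auto simp: regular_cond_distr_def intro: measurable_prob_algebraD)

lemma kernel_prob_space: "prob_space (\<kappa> y)" and kernel_sets[simp, measurable_cong]: "sets (\<kappa> y) = sets borel"
  using regular measurable_space[of \<kappa> borel "prob_algebra borel" y]
  by (auto simp: regular_cond_distr_def space_prob_algebra)

text \<open>The characteristic property of the conditional expectation of the indicator of \<open>X \<in> A\<close>,
  integrated over the event \<open>Y \<in> B\<close> of the sigma-algebra generated by \<open>Y\<close>.\<close>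

lemma emeasure_rectangle:
  assumes [measurable]: "A \<in> sets borel" "B \<in> sets borel"
  shows "emeasure M {\<omega>\<in>space M. Y \<omega> \<in> B \<and> X \<omega> \<in> A}
    = (\<integral>\<^sup>+\<omega>. indicator B (Y \<omega>) * emeasure (\<kappa> (Y \<omega>)) A \<partial>M)"
proof -
  let ?\<A> = "vimage_algebra (space M) Y borel"
  have "subalgebra M ?\<A>"
    unfolding subalgebra_def using measurable_sets[OF Y] by (auto simp: sets_vimage_algebra2)
  then interpret finite_measure_subalgebra M ?\<A> by unfold_locales
  let ?B = "Y -` B \<inter> space M"
  have B: "?B \<in> sets ?\<A>" by (rule in_vimage_algebra) simp
  have [measurable]: "?B \<in> sets M" by simp
  have int: "integrable M (\<lambda>\<omega>. indicator A (X \<omega>) :: real)"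
    by (rule integrable_const_bound[where B=1]) (auto simp: indicator_def)
  have eq: "AE \<omega> in M. real_cond_exp M ?\<A> (\<lambda>\<omega>. indicator A (X \<omega>)) \<omega> = measure (\<kappa> (Y \<omega>)) A"
    using regular by (auto simp: regular_cond_distr_def)
  have m[measurable]: "(\<lambda>\<omega>. measure (\<kappa> (Y \<omega>)) A) \<in> borel_measurable M"
    unfolding measure_def by measurable
  have bnd: "measure (\<kappa> y) A \<le> 1" for y by (rule prob_space.prob_le_1[OF kernel_prob_space])
  have "prob {\<omega>\<in>space M. Y \<omega> \<in> B \<and> X \<omega> \<in> A} = (\<integral>\<omega>\<in>?B. indicator A (X \<omega>) \<partial>M)"
  proof -
    have "prob {\<omega>\<in>space M. Y \<omega> \<in> B \<and> X \<omega> \<in> A}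
      = (\<integral>\<omega>. indicator {\<omega>\<in>space M. Y \<omega> \<in> B \<and> X \<omega> \<in> A} \<omega> \<partial>M)" by simp
    also have "\<dots> = (\<integral>\<omega>\<in>?B. indicator A (X \<omega>) \<partial>M)"
      unfolding set_lebesgue_integral_def
      by (intro Bochner_Integration.integral_cong) (auto simp: indicator_def)
    finally show ?thesis .
  qed
  also have "\<dots> = (\<integral>\<omega>\<in>?B. real_cond_exp M ?\<A> (\<lambda>\<omega>. indicator A (X \<omega>)) \<omega> \<partial>M)"
    by (rule real_cond_exp_intA[OF int B])
  also have "\<dots> = (\<integral>\<omega>. indicator B (Y \<omega>) * measure (\<kappa> (Y \<omega>)) A \<partial>M)"
    unfolding set_lebesgue_integral_def
  proof (rule integral_cong_AE)
    show "AE \<omega> in M. indicat_real ?B \<omega> *\<^sub>R real_cond_exp M ?\<A> (\<lambda>\<omega>. indicator A (X \<omega>)) \<omega>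
        = indicator B (Y \<omega>) * measure (\<kappa> (Y \<omega>)) A"
      using eq AE_space by eventually_elim (auto simp: indicator_def)
  qed auto
  finally have "emeasure M {\<omega>\<in>space M. Y \<omega> \<in> B \<and> X \<omega> \<in> A}
      = ennreal (\<integral>\<omega>. indicator B (Y \<omega>) * measure (\<kappa> (Y \<omega>)) A \<partial>M)"
    by (simp add: emeasure_eq_measure)
  also have "\<dots> = (\<integral>\<^sup>+\<omega>. ennreal (indicator B (Y \<omega>) * measure (\<kappa> (Y \<omega>)) A) \<partial>M)"
    by (rule nn_integral_eq_integral[symmetric])
       (auto intro!: integrable_const_bound[where B=1] simp: indicator_def bnd)
  also have "\<dots> = (\<integral>\<^sup>+\<omega>. indicator B (Y \<omega>) * emeasure (\<kappa> (Y \<omega>)) A \<partial>M)"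
    by (intro nn_integral_cong)
       (auto simp: indicator_def finite_measure.emeasure_eq_measure[OF prob_space.finite_measure[OF kernel_prob_space]])
  finally show ?thesis .
qed

text \<open>Both sides are measures in \<open>C\<close>: the joint law of \<open>(Y, X)\<close>, and the mixture over \<open>\<omega>\<close> of the images
  of \<open>\<kappa> (Y \<omega>)\<close> under \<open>x \<mapsto> (Y \<omega>, x)\<close>. They agree on rectangles, which are stable under
  intersection and generate the product sigma-algebra. The general form is needed because
  \<open>X Y > x\<close> is not a rectangle.\<close>

lemma disintegration:
  assumes C: "C \<in> sets (borel \<Otimes>\<^sub>M borel)"
  shows "emeasure M {\<omega>\<in>space M. (Y \<omega>, X \<omega>) \<in> C}
    = (\<integral>\<^sup>+\<omega>. emeasure (\<kappa> (Y \<omega>)) (Pair (Y \<omega>) -` C) \<partial>M)"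
proof -
  let ?BB = "borel \<Otimes>\<^sub>M borel :: (real \<times> real) measure"
  let ?k = "\<lambda>\<omega>. distr (\<kappa> (Y \<omega>)) ?BB (Pair (Y \<omega>))"
  let ?N = "M \<bind> ?k"
  have k[measurable]: "?k \<in> M \<rightarrow>\<^sub>M subprob_algebra ?BB"
    by (rule measurable_distr2[where M=borel]) measurable
  have N: "emeasure ?N D = (\<integral>\<^sup>+\<omega>. emeasure (\<kappa> (Y \<omega>)) (Pair (Y \<omega>) -` D) \<partial>M)"
    if D[measurable]: "D \<in> sets ?BB" for D
  proof -
    have "emeasure ?N D = (\<integral>\<^sup>+\<omega>. emeasure (?k \<omega>) D \<partial>M)"
      by (rule emeasure_bind[OF not_empty k D])
    also have "\<dots> = (\<integral>\<^sup>+\<omega>. emeasure (\<kappa> (Y \<omega>)) (Pair (Y \<omega>) -` D) \<partial>M)"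
      using sets_eq_imp_space_eq[OF kernel_sets]
      by (intro nn_integral_cong, subst emeasure_distr) auto
    finally show ?thesis .
  qed
  have "distr M ?BB (\<lambda>\<omega>. (Y \<omega>, X \<omega>)) = ?N"
  proof (rule measure_eqI_generator_eq[OF Int_stable_pair_measure_generator,
        where \<Omega>=UNIV and A="\<lambda>_. UNIV"])
    show "sets (distr M ?BB (\<lambda>\<omega>. (Y \<omega>, X \<omega>)))
        = sigma_sets UNIV {a \<times> b |a b. a \<in> sets borel \<and> b \<in> sets borel}"
      by (simp add: sets_pair_measure)
    show "sets ?N = sigma_sets UNIV {a \<times> b |a b. a \<in> sets borel \<and> b \<in> sets borel}"
      using sets_bind[OF _ not_empty, of ?k ?BB] by (simp add: sets_pair_measure)
    show "range (\<lambda>_. UNIV) \<subseteq> {a \<times> b |a b. a \<in> sets borel \<and> b \<in> sets borel}"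
      by (auto intro!: exI[of _ UNIV])
    interpret J: prob_space "distr M ?BB (\<lambda>\<omega>. (Y \<omega>, X \<omega>))" by (rule prob_space_distr) measurable
    show "emeasure (distr M ?BB (\<lambda>\<omega>. (Y \<omega>, X \<omega>))) UNIV \<noteq> \<infinity>"
      using J.emeasure_finite by simp
    fix R :: "(real \<times> real) set" assume "R \<in> {a \<times> b |a b. a \<in> sets borel \<and> b \<in> sets borel}"
    then obtain B A where R: "R = B \<times> A" and [measurable]: "B \<in> sets borel" "A \<in> sets borel" by auto
    have "emeasure (distr M ?BB (\<lambda>\<omega>. (Y \<omega>, X \<omega>))) R = emeasure M {\<omega>\<in>space M. Y \<omega> \<in> B \<and> X \<omega> \<in> A}"
      by (subst emeasure_distr) (auto simp: R intro!: arg_cong[where f="emeasure M"])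
    also have "\<dots> = emeasure ?N R"
      by (subst emeasure_rectangle, simp, simp, subst N)
         (auto simp: R indicator_def intro!: nn_integral_cong)
    finally show "emeasure (distr M ?BB (\<lambda>\<omega>. (Y \<omega>, X \<omega>))) R = emeasure ?N R" .
  qed auto
  then have "emeasure (distr M ?BB (\<lambda>\<omega>. (Y \<omega>, X \<omega>))) C = emeasure ?N C" by simp
  then show ?thesis using C
    by (subst (asm) emeasure_distr) (auto simp: N vimage_def Int_def conj_commute)
qed

lemma measurable_kernel_section:
  assumes D: "D \<in> sets (borel \<Otimes>\<^sub>M borel)"
  shows "(\<lambda>\<omega>. emeasure (\<kappa> (Y \<omega>)) (Pair (Y \<omega>) -` D)) \<in> borel_measurable M"
proof -
  have "(\<lambda>\<omega>. emeasure (distr (\<kappa> (Y \<omega>)) (borel \<Otimes>\<^sub>M borel) (Pair (Y \<omega>))) D) \<in> borel_measurable M"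
    by (rule measurable_compose[OF _ measurable_emeasure_subprob_algebra[OF D]],
        rule measurable_distr2[where M=borel]) measurable
  also have "(\<lambda>\<omega>. emeasure (distr (\<kappa> (Y \<omega>)) (borel \<Otimes>\<^sub>M borel) (Pair (Y \<omega>))) D)
      = (\<lambda>\<omega>. emeasure (\<kappa> (Y \<omega>)) (Pair (Y \<omega>) -` D))"
    using D sets_eq_imp_space_eq[OF kernel_sets] by (intro ext, subst emeasure_distr) auto
  finally show ?thesis .
qed

lemma prob_le_of_conditional_le:
  assumes C: "C \<in> sets (borel \<Otimes>\<^sub>M borel)" and D: "D \<in> sets (borel \<Otimes>\<^sub>M borel)" and "r \<ge> 0"
    and le: "AE \<omega> in M. measure (\<kappa> (Y \<omega>)) (Pair (Y \<omega>) -` C) \<le> r * measure (\<kappa> (Y \<omega>)) (Pair (Y \<omega>) -` D)"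
  shows "prob {\<omega>\<in>space M. (Y \<omega>, X \<omega>) \<in> C} \<le> r * prob {\<omega>\<in>space M. (Y \<omega>, X \<omega>) \<in> D}"
proof -
  have em: "emeasure (\<kappa> y) E = ennreal (measure (\<kappa> y) E)" for y E
    by (rule finite_measure.emeasure_eq_measure[OF prob_space.finite_measure[OF kernel_prob_space]])
  have "ennreal (prob {\<omega>\<in>space M. (Y \<omega>, X \<omega>) \<in> C})
      = (\<integral>\<^sup>+\<omega>. emeasure (\<kappa> (Y \<omega>)) (Pair (Y \<omega>) -` C) \<partial>M)"
    using disintegration[OF C] by (simp add: emeasure_eq_measure)
  also have "\<dots> \<le> (\<integral>\<^sup>+\<omega>. ennreal r * emeasure (\<kappa> (Y \<omega>)) (Pair (Y \<omega>) -` D) \<partial>M)"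
    using le \<open>r \<ge> 0\<close> by (intro nn_integral_mono_AE) (auto simp: em ennreal_mult[symmetric] intro: ennreal_leI)
  also have "\<dots> = ennreal (r * prob {\<omega>\<in>space M. (Y \<omega>, X \<omega>) \<in> D})"
    using disintegration[OF D] measurable_kernel_section[OF D] \<open>r \<ge> 0\<close>
    by (simp add: nn_integral_cmult emeasure_eq_measure ennreal_mult)
  finally show ?thesis using \<open>r \<ge> 0\<close> by simp
qed

end


section \<open>Conditional tails comparable to the unconditional tail\<close>

text \<open>Up to factors \<open>1 \<plusminus> \<epsilon>\<close> with \<open>(1 + \<epsilon>) / (1 - \<epsilon>) = \<eta>\<close>, both \<open>k y s\<close> and \<open>k y t\<close> are \<open>h y\<close> times
  \<open>f\<close>, so cross-multiplying eliminates \<open>h\<close>.\<close>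

lemma tail_comparison_of_uniform_equivalence:
  fixes k :: "real \<Rightarrow> real \<Rightarrow> real"
  assumes unif: "uniform_limit S (\<lambda>x y. k y x / (h y * f x)) (\<lambda>y. 1) at_top"
    and h: "\<And>y. y \<in> S \<Longrightarrow> h y > 0" and f: "\<And>x. x \<ge> 0 \<Longrightarrow> f x > 0" and "\<eta> > 1"
  shows "\<exists>s\<^sub>0. \<forall>y\<in>S. \<forall>s\<ge>s\<^sub>0. k y s > 0 \<and> (\<forall>t\<ge>s\<^sub>0. k y s * f t \<le> \<eta> * k y t * f s)"
proof -
  define \<epsilon> where "\<epsilon> = (\<eta> - 1) / (\<eta> + 1)"
  have \<epsilon>: "\<epsilon> > 0" "\<epsilon> < 1" "1 + \<epsilon> = \<eta> * (1 - \<epsilon>)" using \<open>\<eta> > 1\<close> by (auto simp: \<epsilon>_def field_simps)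
  from uniform_limitD[OF unif \<epsilon>(1)] obtain s\<^sub>1 where
    s1: "\<And>s y. s \<ge> s\<^sub>1 \<Longrightarrow> y \<in> S \<Longrightarrow> dist (k y s / (h y * f s)) 1 < \<epsilon>"
    by (auto simp: eventually_at_top_linorder)
  let ?s = "max s\<^sub>1 0"
  have bounds: "(1 - \<epsilon>) * (h y * f s) < k y s" "k y s < (1 + \<epsilon>) * (h y * f s)"
    if "y \<in> S" "s \<ge> ?s" for y s
  proof -
    have pos: "h y * f s > 0" using h f that by simp
    have "1 - \<epsilon> < k y s / (h y * f s)" "k y s / (h y * f s) < 1 + \<epsilon>"
      using s1[of s y] that by (auto simp: dist_real_def abs_less_iff)
    then show "(1 - \<epsilon>) * (h y * f s) < k y s" "k y s < (1 + \<epsilon>) * (h y * f s)"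
      using pos by (simp_all only: less_divide_eq divide_less_eq if_True)
  qed
  show ?thesis
  proof (intro exI[of _ ?s] ballI allI impI conjI)
    fix y s assume y: "y \<in> S" and s: "s \<ge> ?s"
    have "0 < (1 - \<epsilon>) * (h y * f s)" using h[OF y] f[of s] s \<epsilon> by simp
    then show "k y s > 0" using bounds[OF y s] by linarith
    fix t assume t: "t \<ge> ?s"
    have "k y s * f t \<le> ((1 + \<epsilon>) * (h y * f s)) * f t"
      using bounds(2)[OF y s] f[of t] t by (intro mult_right_mono) auto
    also have "\<dots> = (\<eta> * ((1 - \<epsilon>) * (h y * f t))) * f s" by (simp add: \<epsilon>)
    also have "\<dots> \<le> (\<eta> * k y t) * f s"
      using bounds(1)[OF y t] f[of s] s \<open>\<eta> > 1\<close> by (intro mult_right_mono mult_left_mono) auto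
    finally show "k y s * f t \<le> \<eta> * k y t * f s" .
  qed
qed

text \<open>The hypothesis \<open>comparable\<close> is the form in which (B) is used: \<open>P[X > s | Y = y]\<close> and
  \<open>tail F s\<close> are nearly proportional as functions of large \<open>s\<close>, uniformly in \<open>y\<close>, with the
  factor of proportionality eliminated.\<close>

locale conditionally_comparable_pair = conditioned_pair +
  fixes S :: "real set"
  assumes AE_S: "AE \<omega> in M. Y \<omega> \<in> S"
    and S_nonneg: "y \<in> S \<Longrightarrow> 0 \<le> y"
    and Y_not_null: "prob {\<omega>\<in>space M. 0 < Y \<omega>} > 0"
    and comparable: "\<eta> > 1 \<Longrightarrow> \<exists>s\<^sub>0. \<forall>y\<in>S. \<forall>s\<ge>s\<^sub>0. measure (\<kappa> y) {s<..} > 0 \<and>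
      (\<forall>t\<ge>s\<^sub>0. measure (\<kappa> y) {s<..} * tail (distr M borel X) t
        \<le> \<eta> * measure (\<kappa> y) {t<..} * tail (distr M borel X) s)"
    and F_pd: "distr M borel X \<in> positively_decreasing"
begin

abbreviation "F \<equiv> distr M borel X"
abbreviation "H \<equiv> distr M borel (\<lambda>\<omega>. X \<omega> * Y \<omega>)"

lemma tail_F_pos: "x \<ge> 0 \<Longrightarrow> tail F x > 0"
  using F_pd by (auto simp: positively_decreasing_def)

lemma tail_F_antimono: "x \<le> y \<Longrightarrow> tail F y \<le> tail F x"
  unfolding tail_distr[OF X] by (rule finite_measure_mono) auto

lemma tail_H: "tail H x = prob {\<omega>\<in>space M. x < X \<omega> * Y \<omega>}"
  by (rule tail_distr) measurable

lemma tail_H_antimono: "x \<le> y \<Longrightarrow> tail H y \<le> tail H x"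
  unfolding tail_H by (rule finite_measure_mono) auto

text \<open>An inequality between two tails of \<open>F\<close> transfers to the conditional tails with a loss \<open>\<eta>\<close>
  arbitrarily close to \<open>1\<close>. The threshold \<open>s\<^sub>0\<close> depends on neither \<open>y\<close> nor \<open>q\<close>.\<close>

lemma comparable_shifted_tail:
  assumes "\<eta> > 1"
  obtains s\<^sub>0 where "s\<^sub>0 > 0"
    "\<And>y s s' q. y \<in> S \<Longrightarrow> s \<ge> s\<^sub>0 \<Longrightarrow> s' \<ge> s\<^sub>0 \<Longrightarrow> tail F s' \<le> q * tail F s \<Longrightarrow>
      measure (\<kappa> y) {s'<..} \<le> \<eta> * q * measure (\<kappa> y) {s<..}"
proof -
  obtain s\<^sub>0 where s0: "\<And>y s t. y \<in> S \<Longrightarrow> s \<ge> s\<^sub>0 \<Longrightarrow> t \<ge> s\<^sub>0 \<Longrightarrow>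
      measure (\<kappa> y) {s<..} * tail F t \<le> \<eta> * measure (\<kappa> y) {t<..} * tail F s"
    using comparable[OF assms] by blast
  show ?thesis
  proof
    show "max s\<^sub>0 1 > 0" by simp
    fix y s s' q assume y: "y \<in> S" and s: "s \<ge> max s\<^sub>0 1" "s' \<ge> max s\<^sub>0 1"
      and q: "tail F s' \<le> q * tail F s"
    have "measure (\<kappa> y) {s'<..} * tail F s \<le> \<eta> * measure (\<kappa> y) {s<..} * tail F s'"
      using s0[of y s' s] y s by auto
    also have "\<dots> \<le> \<eta> * measure (\<kappa> y) {s<..} * (q * tail F s)"
      using q assms by (intro mult_left_mono) auto
    finally have "measure (\<kappa> y) {s'<..} * tail F s \<le> (\<eta> * q * measure (\<kappa> y) {s<..}) * tail F s"
      by (simp add: mult_ac)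
    then show "measure (\<kappa> y) {s'<..} \<le> \<eta> * q * measure (\<kappa> y) {s<..}"
      using tail_F_pos[of s] s by simp
  qed
qed

section \<open>The tail of the product\<close>

text \<open>For \<open>y > 0\<close> the sections at \<open>y\<close> of \<open>X Y > x'\<close> and \<open>X Y > x\<close> are \<open>X > x'/y\<close> and \<open>X > x/y\<close>, so
  integrating an inequality between conditional tails over a band of values of \<open>Y\<close> gives an
  inequality between tails of the product.\<close>

lemma band_le_tail_product:
  assumes "0 \<le> \<delta>" "0 \<le> r"
    and le: "\<And>y. y \<in> S \<Longrightarrow> \<delta> < y \<Longrightarrow> y \<le> w \<Longrightarrow>
      measure (\<kappa> y) {x'/y<..} \<le> r * measure (\<kappa> y) {x/y<..}"
  shows "prob {\<omega>\<in>space M. \<delta> < Y \<omega> \<and> Y \<omega> \<le> w \<and> x' < X \<omega> * Y \<omega>} \<le> r * tail H x"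
proof -
  let ?BB = "borel \<Otimes>\<^sub>M borel :: (real \<times> real) measure"
  let ?C = "{p. \<delta> < fst p \<and> fst p \<le> w \<and> x' < snd p * fst p}"
  let ?D = "{p. x < snd p * fst p}"
  have "{p\<in>space ?BB. \<delta> < fst p \<and> fst p \<le> w \<and> x' < snd p * fst p} \<in> sets ?BB"
    and "{p\<in>space ?BB. x < snd p * fst p} \<in> sets ?BB" by measurable
  then have CD: "?C \<in> sets ?BB" "?D \<in> sets ?BB" by (simp_all add: space_pair_measure)
  have "prob {\<omega>\<in>space M. (Y \<omega>, X \<omega>) \<in> ?C} \<le> r * prob {\<omega>\<in>space M. (Y \<omega>, X \<omega>) \<in> ?D}"
  proof (rule prob_le_of_conditional_le[OF CD \<open>0 \<le> r\<close>])
    show "AE \<omega> in M. measure (\<kappa> (Y \<omega>)) (Pair (Y \<omega>) -` ?C) \<le> r * measure (\<kappa> (Y \<omega>)) (Pair (Y \<omega>) -` ?D)"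
      using AE_S
    proof eventually_elim
      case (elim \<omega>)
      show ?case
      proof (cases "\<delta> < Y \<omega> \<and> Y \<omega> \<le> w")
        case True
        then have "0 < Y \<omega>" using \<open>0 \<le> \<delta>\<close> by auto
        then have "Pair (Y \<omega>) -` ?C = {x'/Y \<omega><..}" "Pair (Y \<omega>) -` ?D = {x/Y \<omega><..}"
          using True by (auto simp: divide_simps)
        then show ?thesis using le[OF elim] True by simp
      next
        case False
        then have "Pair (Y \<omega>) -` ?C = {}" by auto
        then show ?thesis using \<open>0 \<le> r\<close> by (simp only: measure_empty) simp
      qed
    qed
  qed
  then show ?thesis by (simp add: tail_H)
qed

lemma tail_product_split:
  "tail H x \<le> prob {\<omega>\<in>space M. Y \<omega> \<le> \<delta> \<and> x < X \<omega> * Y \<omega>}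
    + prob {\<omega>\<in>space M. \<delta> < Y \<omega> \<and> Y \<omega> \<le> w \<and> x < X \<omega> * Y \<omega>} + tail (distr M borel Y) w"
proof -
  let ?A = "{\<omega>\<in>space M. Y \<omega> \<le> \<delta> \<and> x < X \<omega> * Y \<omega>}"
  let ?B = "{\<omega>\<in>space M. \<delta> < Y \<omega> \<and> Y \<omega> \<le> w \<and> x < X \<omega> * Y \<omega>}"
  let ?C = "{\<omega>\<in>space M. w < Y \<omega>}"
  have "tail H x \<le> prob (?A \<union> ?B \<union> ?C)"
    unfolding tail_H by (rule finite_measure_mono) auto
  also have "\<dots> \<le> prob (?A \<union> ?B) + prob ?C" by (rule measure_Un_le) auto
  also have "prob (?A \<union> ?B) \<le> prob ?A + prob ?B" by (rule measure_Un_le) auto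
  finally show ?thesis by (simp add: tail_distr)
qed

lemma zero_factor_null:
  assumes "0 \<le> x"
  shows "prob {\<omega>\<in>space M. Y \<omega> \<le> 0 \<and> x < X \<omega> * Y \<omega>} = 0"
proof -
  have "AE \<omega> in M. \<not> (Y \<omega> \<le> 0 \<and> x < X \<omega> * Y \<omega>)"
    using AE_S
  proof eventually_elim
    case (elim \<omega>)
    with S_nonneg have "Y \<omega> \<le> 0 \<Longrightarrow> Y \<omega> = 0" by force
    then show ?case using \<open>0 \<le> x\<close> by auto
  qed
  then show ?thesis by (subst prob_eq_0) auto
qed

text \<open>Here \<open>x > 0\<close> matters: \<open>X Y > x\<close> with \<open>Y \<ge> 0\<close> forces \<open>X > 0\<close>, so replacing \<open>Y\<close> by the larger
  \<open>\<delta>\<close> increases the product.\<close>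

lemma small_factor_le_tail:
  assumes "0 < \<delta>" "0 < x"
  shows "prob {\<omega>\<in>space M. Y \<omega> \<le> \<delta> \<and> x < X \<omega> * Y \<omega>} \<le> tail F (x / \<delta>)"
proof -
  have "AE \<omega> in M. \<omega> \<in> {\<omega>\<in>space M. Y \<omega> \<le> \<delta> \<and> x < X \<omega> * Y \<omega>} \<longrightarrow> \<omega> \<in> {\<omega>\<in>space M. x / \<delta> < X \<omega>}"
    using AE_S
  proof eventually_elim
    case (elim \<omega>)
    show ?case
    proof safe
      assume Y: "Y \<omega> \<le> \<delta>" and x: "x < X \<omega> * Y \<omega>"
      have "0 \<le> Y \<omega>" by (rule S_nonneg[OF elim])
      then have "0 < X \<omega>" using x \<open>0 < x\<close> by (smt (verit) mult_nonpos_nonneg)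
      then have "X \<omega> * Y \<omega> \<le> X \<omega> * \<delta>" using Y by (intro mult_left_mono) auto
      then show "x / \<delta> < X \<omega>" using x \<open>0 < \<delta>\<close> by (simp add: divide_simps)
    qed
  qed
  then have "prob {\<omega>\<in>space M. Y \<omega> \<le> \<delta> \<and> x < X \<omega> * Y \<omega>} \<le> prob {\<omega>\<in>space M. x / \<delta> < X \<omega>}"
    by (rule finite_measure_mono_AE) auto
  then show ?thesis by (simp add: tail_distr)
qed

text \<open>Choose \<open>d > 0\<close> with \<open>P[Y > d] > 0\<close>. The tail of the product at \<open>x\<close> is at least
  \<open>P[X > x/d, Y > d]\<close>. Comparing conditional tails at \<open>x/d\<close> and at a fixed large level \<open>t\<close> shows that this is
  at least a multiple of \<open>P[X > t, Y > d] tail F (x/d)\<close>, and \<open>P[X > t, Y > d]\<close> is positive because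
  the conditional tail at \<open>t\<close> is positive for every \<open>y\<close> in \<open>S\<close>.\<close>

lemma tail_product_lower_bound:
  obtains C d x\<^sub>0 where "C > 0" "d > 0" "\<And>x. x \<ge> x\<^sub>0 \<Longrightarrow> C * tail F (x / d) \<le> tail H x"
proof -
  obtain d where d: "d > 0" "prob {\<omega>\<in>space M. d < Y \<omega>} > 0"
  proof (rule ccontr)
    assume "\<not> thesis"
    with that have *: "prob {\<omega>\<in>space M. d < Y \<omega>} = 0" if "d > 0" for d
      using that by (meson measure_le_0_iff not_less)
    have "AE \<omega> in M. \<not> inverse (Suc n) < Y \<omega>" for n
    proof -
      have "prob {\<omega>\<in>space M. inverse (Suc n) < Y \<omega>} = 0" by (rule *) simp
      then show ?thesis by (subst (asm) prob_eq_0) auto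
    qed
    then have "AE \<omega> in M. \<forall>n::nat. \<not> inverse (Suc n) < Y \<omega>"
      by (subst AE_all_countable) blast
    then have "AE \<omega> in M. \<not> 0 < Y \<omega>"
      by eventually_elim (use reals_Archimedean in blast)
    then have "prob {\<omega>\<in>space M. 0 < Y \<omega>} = 0" by (subst prob_eq_0) auto
    then show False using Y_not_null by simp
  qed
  obtain s\<^sub>0 where "s\<^sub>0 > 0" and s0: "\<And>y s s' q. y \<in> S \<Longrightarrow> s \<ge> s\<^sub>0 \<Longrightarrow> s' \<ge> s\<^sub>0 \<Longrightarrow>
      tail F s' \<le> q * tail F s \<Longrightarrow> measure (\<kappa> y) {s'<..} \<le> 2 * q * measure (\<kappa> y) {s<..}"
    using comparable_shifted_tail[of 2] by auto
  obtain s\<^sub>1 where s1: "\<And>y s. y \<in> S \<Longrightarrow> s \<ge> s\<^sub>1 \<Longrightarrow> measure (\<kappa> y) {s<..} > 0"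
    using comparable[of 2] by auto
  define t where "t = max s\<^sub>0 s\<^sub>1"
  have t: "t > 0" "t \<ge> s\<^sub>0" "t \<ge> s\<^sub>1" using \<open>s\<^sub>0 > 0\<close> by (auto simp: t_def)
  let ?BB = "borel \<Otimes>\<^sub>M borel :: (real \<times> real) measure"
  define E where "E s = {p. d < fst p \<and> s < snd p}" for s :: real
  have E: "E s \<in> sets ?BB" for s
  proof -
    have "{p\<in>space ?BB. d < fst p \<and> s < snd p} \<in> sets ?BB" by measurable
    then show ?thesis by (simp add: space_pair_measure E_def)
  qed
  have E_section: "Pair y -` E s = (if d < y then {s<..} else {})" for y s by (auto simp: E_def)
  let ?p = "\<lambda>s. prob {\<omega>\<in>space M. (Y \<omega>, X \<omega>) \<in> E s}"
  have p_pos: "?p t > 0"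
  proof (rule ccontr)
    assume "\<not> ?p t > 0"
    then have "?p t = 0" by (simp add: zero_less_measure_iff)
    have zero: "(\<integral>\<^sup>+\<omega>. emeasure (\<kappa> (Y \<omega>)) (Pair (Y \<omega>) -` E t) \<partial>M) = 0"
      using disintegration[OF E[of t]] \<open>?p t = 0\<close> by (simp add: emeasure_eq_measure)
    have "AE \<omega> in M. emeasure (\<kappa> (Y \<omega>)) (Pair (Y \<omega>) -` E t) = 0"
      using zero by (subst (asm) nn_integral_0_iff_AE) (auto intro: measurable_kernel_section E)
    with AE_S have "AE \<omega> in M. \<not> d < Y \<omega>"
    proof eventually_elim
      case (elim \<omega>)
      then show ?case using s1[OF elim(1) t(3)]
        by (auto simp: E_section measure_def split: if_splits)
    qed
    then have "prob {\<omega>\<in>space M. d < Y \<omega>} = 0" by (subst prob_eq_0) auto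
    then show False using d by simp
  qed
  define C where "C = ?p t / (2 * tail F t)"
  show ?thesis
  proof
    show "C > 0" using p_pos tail_F_pos[of t] t by (simp add: C_def)
    show "d > 0" by fact
    fix x assume x: "x \<ge> d * t"
    then have xd: "x / d \<ge> t" using \<open>d > 0\<close> by (simp add: field_simps)
    have pos: "tail F (x / d) > 0" "tail F t > 0" using tail_F_pos xd t by auto
    define q where "q = tail F t / tail F (x / d)"
    have q: "q > 0" "tail F t \<le> q * tail F (x / d)" using pos by (auto simp: q_def)
    have "?p t \<le> (2 * q) * ?p (x / d)"
    proof (rule prob_le_of_conditional_le[OF E E])
      show "AE \<omega> in M. measure (\<kappa> (Y \<omega>)) (Pair (Y \<omega>) -` E t)
          \<le> 2 * q * measure (\<kappa> (Y \<omega>)) (Pair (Y \<omega>) -` E (x / d))"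
        using AE_S by eventually_elim (use s0 q xd t in \<open>auto simp: E_section\<close>)
    qed (use q in auto)
    also have "?p (x / d) \<le> tail H x"
      unfolding tail_H
    proof (rule finite_measure_mono)
      have "x < u * y" if "d < y" "x / d < u" for y u
      proof -
        have "x < u * d" using that \<open>d > 0\<close> by (simp add: divide_simps)
        also have "\<dots> \<le> u * y" using that xd t \<open>d > 0\<close> by (intro mult_left_mono) auto
        finally show ?thesis .
      qed
      then show "{\<omega>\<in>space M. (Y \<omega>, X \<omega>) \<in> E (x / d)} \<subseteq> {\<omega>\<in>space M. x < X \<omega> * Y \<omega>}"
        by (auto simp: E_def)
    qed measurable
    finally show "C * tail F (x / d) \<le> tail H x"
      using pos q by (simp add: C_def q_def field_simps)
  qed
qed

lemma tail_product_pos: "tail H x > 0"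
proof -
  obtain C d x\<^sub>0 where C: "C > 0" "d > 0" "\<And>x. x \<ge> x\<^sub>0 \<Longrightarrow> C * tail F (x / d) \<le> tail H x"
    using tail_product_lower_bound by blast
  let ?x = "max 0 (max x x\<^sub>0)"
  have "0 < C * tail F (?x / d)" using C tail_F_pos[of "?x / d"] by simp
  also have "\<dots> \<le> tail H ?x" using C(3)[of ?x] by simp
  also have "\<dots> \<le> tail H x" by (rule tail_H_antimono) simp
  finally show ?thesis .
qed

text \<open>The left-hand side is at most \<open>tail F ((x - a)/\<delta>)\<close> and \<open>tail H x\<close> is at least
  \<open>C * tail F (x/d)\<close>; positive decrease makes the ratio small when \<open>d/\<delta>\<close> is large.\<close>

lemma small_factor_negligible:
  assumes "\<epsilon> > 0"
  obtains \<delta> where "\<delta> > 0"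
    "eventually (\<lambda>x. prob {\<omega>\<in>space M. Y \<omega> \<le> \<delta> \<and> x - a < X \<omega> * Y \<omega>} \<le> \<epsilon> * tail H x) at_top"
proof -
  obtain C d x\<^sub>0 where C: "C > 0" "d > 0" "\<And>x. x \<ge> x\<^sub>0 \<Longrightarrow> C * tail F (x / d) \<le> tail H x"
    using tail_product_lower_bound by blast
  obtain n s\<^sub>0 where n: "\<And>s. s \<ge> s\<^sub>0 \<Longrightarrow> tail F (2 ^ n * s) \<le> (\<epsilon> * C) * tail F s"
    using positively_decreasing_power[OF F_pd mult_pos_pos[OF assms C(1)]] by blast
  \<comment> \<open>The extra factor \<open>2\<close> absorbs the shift, since \<open>x - a \<ge> x/2\<close> for \<open>x \<ge> 2 a\<close>.\<close>
  define \<delta> where "\<delta> = d / (2 * 2 ^ n)"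
  show ?thesis
  proof
    show "\<delta> > 0" using C by (simp add: \<delta>_def)
    show "eventually (\<lambda>x. prob {\<omega>\<in>space M. Y \<omega> \<le> \<delta> \<and> x - a < X \<omega> * Y \<omega>} \<le> \<epsilon> * tail H x) at_top"
      using eventually_ge_at_top[of "2 * a"] eventually_gt_at_top[of a] eventually_ge_at_top[of x\<^sub>0]
        eventually_ge_at_top[of "d * s\<^sub>0"]
    proof eventually_elim
      case (elim x)
      have "2 ^ n * (x / d) \<le> (x - a) / \<delta>"
        using C elim by (simp add: \<delta>_def field_simps)
      then have "prob {\<omega>\<in>space M. Y \<omega> \<le> \<delta> \<and> x - a < X \<omega> * Y \<omega>} \<le> tail F (2 ^ n * (x / d))"
        using small_factor_le_tail[of \<delta> "x - a"] \<open>\<delta> > 0\<close> elim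
          tail_F_antimono[of "2 ^ n * (x / d)" "(x - a) / \<delta>"] by simp
      also have "\<dots> \<le> (\<epsilon> * C) * tail F (x / d)"
        using elim C by (intro n) (simp add: field_simps)
      also have "\<dots> \<le> \<epsilon> * tail H x" using C(3)[of x] elim assms by (simp add: mult.assoc)
      finally show ?case .
    qed
  qed
qed

text \<open>On \<open>0 < Y \<le> x/m\<close> the bound \<open>tail F (v s) \<le> q * tail F s\<close> holds at \<open>s = x/y \<ge> m\<close>, while
  \<open>Y > x/m\<close> contributes \<open>o(tail H x)\<close>.\<close>

lemma product_positively_decreasing:
  assumes A: "\<And>c. c > 0 \<Longrightarrow> (\<lambda>x. tail (distr M borel Y) (c * x)) \<in> o[at_top](tail H)"
  shows "H \<in> positively_decreasing"
proof -
  have "Limsup at_top (\<lambda>x. ereal (tail H (v * x) / tail H x)) < 1" if v: "v > 1" for v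
  proof -
    obtain q s\<^sub>1 where q: "0 < q" "q < 1" "s\<^sub>1 > 0" "\<And>s. s \<ge> s\<^sub>1 \<Longrightarrow> tail F (v * s) \<le> q * tail F s"
      using positively_decreasingD[OF F_pd v] by blast
    \<comment> \<open>This loss in the conditional comparison keeps the constant \<open>\<eta> * q = sqrt q\<close> below \<open>1\<close>.\<close>
    define \<eta> where "\<eta> = 1 / sqrt q"
    have \<eta>: "\<eta> > 1" "\<eta> * q = sqrt q" "sqrt q < 1"
      using q by (auto simp: \<eta>_def real_div_sqrt)
    obtain s\<^sub>0 where "s\<^sub>0 > 0" and s0: "\<And>y s s' q. y \<in> S \<Longrightarrow> s \<ge> s\<^sub>0 \<Longrightarrow> s' \<ge> s\<^sub>0 \<Longrightarrow>
      tail F s' \<le> q * tail F s \<Longrightarrow> measure (\<kappa> y) {s'<..} \<le> \<eta> * q * measure (\<kappa> y) {s<..}"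
      using comparable_shifted_tail[OF \<eta>(1)] by blast
    define m where "m = max s\<^sub>0 s\<^sub>1"
    have m: "m > 0" "m \<ge> s\<^sub>0" "m \<ge> s\<^sub>1" using q by (auto simp: m_def)
    define \<epsilon> where "\<epsilon> = (1 - sqrt q) / 2"
    have "sqrt q = 1 - 2 * \<epsilon>" by (simp add: \<epsilon>_def field_simps)
    with \<eta>(3) have \<epsilon>: "\<epsilon> > 0" "sqrt q + \<epsilon> < 1" by linarith+
    have "eventually (\<lambda>x. norm (tail (distr M borel Y) (1 / m * x)) \<le> \<epsilon> * norm (tail H x)) at_top"
      by (rule landau_o.smallD[OF A]) (use m \<epsilon> in auto)
    then have "eventually (\<lambda>x. ereal (tail H (v * x) / tail H x) \<le> ereal (sqrt q + \<epsilon>)) at_top"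
      using eventually_gt_at_top[of 0]
    proof eventually_elim
      case (elim x)
      have "prob {\<omega>\<in>space M. Y \<omega> \<le> 0 \<and> v * x < X \<omega> * Y \<omega>} = 0"
        using zero_factor_null[of "v * x"] elim v by simp
      moreover have "prob {\<omega>\<in>space M. 0 < Y \<omega> \<and> Y \<omega> \<le> x / m \<and> v * x < X \<omega> * Y \<omega>} \<le> sqrt q * tail H x"
      proof (rule band_le_tail_product)
        fix y assume y: "y \<in> S" "0 < y" "y \<le> x / m"
        then have xy: "m \<le> x / y" using m by (simp add: field_simps)
        have "1 * (x / y) \<le> v * (x / y)" using xy m v by (intro mult_right_mono) auto
        then have "measure (\<kappa> y) {v * (x / y)<..} \<le> \<eta> * q * measure (\<kappa> y) {x/y<..}"
          using s0[of y "x / y" "v * (x / y)" q] q(4)[of "x / y"] y xy m by auto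
        then show "measure (\<kappa> y) {v * x / y<..} \<le> sqrt q * measure (\<kappa> y) {x/y<..}"
          by (simp add: \<eta>)
      qed (use q in auto)
      moreover have "tail (distr M borel Y) (x / m) \<le> \<epsilon> * tail H x"
        using elim(1) tail_product_pos[of x] by simp
      ultimately have "tail H (v * x) \<le> (sqrt q + \<epsilon>) * tail H x"
        using tail_product_split[of "v * x" 0 "x / m"] by (simp add: algebra_simps)
      then show ?case using tail_product_pos[of x] by (simp add: divide_simps)
    qed
    then have "Limsup at_top (\<lambda>x. ereal (tail H (v * x) / tail H x)) \<le> ereal (sqrt q + \<epsilon>)"
      by (rule Limsup_bounded)
    also have "\<dots> < 1" using \<epsilon> by simp
    finally show ?thesis .
  qed
  then show ?thesis using tail_product_pos
    by (auto simp: positively_decreasing_def)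
qed

text \<open>Three ranges of \<open>Y\<close>: at most \<open>\<delta>\<close>, where positive decrease of \<open>F\<close> makes the contribution
  negligible; between \<open>\<delta>\<close> and \<open>x/m\<close>, where the shift \<open>a/y\<close> of \<open>x/y\<close> is at most \<open>a/\<delta>\<close> and \<open>F\<close> is
  long tailed; and above \<open>x/m\<close>, where (A) applies.\<close>

lemma product_long_tailed:
  assumes A: "\<And>c. c > 0 \<Longrightarrow> (\<lambda>x. tail (distr M borel Y) (c * x)) \<in> o[at_top](tail H)"
    and F: "F \<in> long_tailed"
  shows "H \<in> long_tailed"
proof -
  have "((\<lambda>x. tail H (x - a) / tail H x) \<longlongrightarrow> 1) at_top" if a: "a > 0" for a
  proof (rule tendstoI)
    fix e :: real assume "e > 0"
    define \<epsilon> where "\<epsilon> = e / 4"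
    have \<epsilon>: "\<epsilon> > 0" "\<epsilon> + (1 + \<epsilon>) + \<epsilon> < 1 + e" using \<open>e > 0\<close> by (auto simp: \<epsilon>_def)
    \<comment> \<open>One factor \<open>\<eta>\<close> is lost in the conditional comparison, another in the long tail of \<open>F\<close>.\<close>
    define \<eta> where "\<eta> = sqrt (1 + \<epsilon>)"
    have \<eta>: "\<eta> > 1" "\<eta> * \<eta> = 1 + \<epsilon>" using \<epsilon> by (auto simp: \<eta>_def)
    obtain \<delta> where \<delta>: "\<delta> > 0" and small:
      "eventually (\<lambda>x. prob {\<omega>\<in>space M. Y \<omega> \<le> \<delta> \<and> x - a < X \<omega> * Y \<omega>} \<le> \<epsilon> * tail H x) at_top"
      using small_factor_negligible[OF \<epsilon>(1)] by blast
    have "((\<lambda>s. tail F (s - a / \<delta>) / tail F s) \<longlongrightarrow> 1) at_top"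
      using F a \<delta> by (simp add: long_tailed_def)
    from order_tendstoD(2)[OF this \<eta>(1)] obtain s\<^sub>1 where
      s1: "\<And>s. s \<ge> s\<^sub>1 \<Longrightarrow> tail F (s - a / \<delta>) / tail F s < \<eta>"
      by (auto simp: eventually_at_top_linorder)
    obtain s\<^sub>0 where "s\<^sub>0 > 0" and s0: "\<And>y s s' q. y \<in> S \<Longrightarrow> s \<ge> s\<^sub>0 \<Longrightarrow> s' \<ge> s\<^sub>0 \<Longrightarrow>
      tail F s' \<le> q * tail F s \<Longrightarrow> measure (\<kappa> y) {s'<..} \<le> \<eta> * q * measure (\<kappa> y) {s<..}"
      using comparable_shifted_tail[OF \<eta>(1)] by blast
    \<comment> \<open>Both \<open>x/y\<close> and the shifted level \<open>x/y - a/\<delta>\<close> must exceed \<open>s\<^sub>0\<close>.\<close>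
    define m where "m = max (s\<^sub>0 + a / \<delta>) s\<^sub>1"
    have "a / \<delta> > 0" using a \<delta> by simp
    then have m: "m > 0" "m \<ge> s\<^sub>0 + a / \<delta>" "m \<ge> s\<^sub>0" "m \<ge> s\<^sub>1"
      using \<open>s\<^sub>0 > 0\<close> by (auto simp: m_def)
    have "eventually (\<lambda>x. norm (tail (distr M borel Y) (1 / m * x)) \<le> \<epsilon> * norm (tail H x)) at_top"
      by (rule landau_o.smallD[OF A]) (use m \<epsilon> in auto)
    then show "eventually (\<lambda>x. dist (tail H (x - a) / tail H x) 1 < e) at_top"
      using small eventually_gt_at_top[of 0]
    proof eventually_elim
      case (elim x)
      have "prob {\<omega>\<in>space M. \<delta> < Y \<omega> \<and> Y \<omega> \<le> x / m \<and> x - a < X \<omega> * Y \<omega>} \<le> (1 + \<epsilon>) * tail H x"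
      proof (rule band_le_tail_product)
        fix y assume y: "y \<in> S" "\<delta> < y" "y \<le> x / m"
        then have xy: "m \<le> x / y" using m \<delta> by (simp add: field_simps)
        have "a / y \<le> a / \<delta>" using a y \<delta> by (intro divide_left_mono) auto
        then have "measure (\<kappa> y) {(x - a) / y<..} \<le> measure (\<kappa> y) {x / y - a / \<delta><..}"
          by (intro finite_measure.finite_measure_mono prob_space.finite_measure[OF kernel_prob_space])
             (auto simp: diff_divide_distrib)
        also have "\<dots> \<le> \<eta> * \<eta> * measure (\<kappa> y) {x / y<..}"
        proof (rule s0)
          show "tail F (x / y - a / \<delta>) \<le> \<eta> * tail F (x / y)"
          proof -
            have "tail F (x / y - a / \<delta>) / tail F (x / y) < \<eta>" "tail F (x / y) > 0"
              using s1[of "x / y"] tail_F_pos[of "x / y"] xy m by auto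
            then show ?thesis by (simp only: pos_divide_less_eq less_imp_le)
          qed
        qed (use y xy m in auto)
        finally show "measure (\<kappa> y) {(x - a) / y<..} \<le> (1 + \<epsilon>) * measure (\<kappa> y) {x / y<..}"
          by (simp add: \<eta>)
      qed (use \<delta> \<epsilon> in auto)
      moreover have "tail (distr M borel Y) (x / m) \<le> \<epsilon> * tail H x"
        using elim(1) tail_product_pos[of x] by simp
      ultimately have "tail H (x - a) \<le> (\<epsilon> + (1 + \<epsilon>) + \<epsilon>) * tail H x"
        using tail_product_split[of "x - a" \<delta> "x / m"] elim(2) by (simp add: algebra_simps)
      also have "\<dots> < (1 + e) * tail H x"
        using \<epsilon> tail_product_pos[of x] by (intro mult_strict_right_mono) auto
      finally have "tail H (x - a) / tail H x < 1 + e"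
        using tail_product_pos[of x] by (simp add: divide_simps)
      moreover have "tail H (x - a) / tail H x \<ge> 1"
        using tail_product_pos[of x] tail_H_antimono[of "x - a" x] a by (simp add: divide_simps)
      ultimately show ?case by (simp add: dist_real_def)
    qed
  qed
  then show ?thesis using tail_product_pos by (auto simp: long_tailed_def)
qed

end

section \<open>The closure theorem\<close>

theorem theorem3p1:
  fixes M :: "'a measure" and X Y :: "'a \<Rightarrow> real"
    and F G H :: "real measure" and \<kappa> :: "real \<Rightarrow> real measure"
  assumes "prob_space M"
    and "X \<in> borel_measurable M" and "Y \<in> borel_measurable M"
    and F: "F = distr M borel X"
    and G: "G = distr M borel Y"
    and H: "H = distr M borel (\<lambda>\<omega>. X \<omega> * Y \<omega>)"
    and "distr_support F = UNIV"
    and "(cdf G \<longlongrightarrow> 0) (at_left 0)" and "cdf G 0 < 1"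
    and "regular_cond_distr M X Y \<kappa>"
    and A: "\<forall>c>0. (\<lambda>x. tail G (c * x)) \<in> o[at_top](tail H)"
    and B: "\<exists>h :: real \<Rightarrow> real. (\<forall>y\<ge>0. h y > 0) \<and>
        uniform_limit (distr_support G)
          (\<lambda>x y. measure (\<kappa> y) {x<..} / (h y * tail F x)) (\<lambda>y. 1) at_top"
    and "F \<in> class_T"
  shows "H \<in> class_T"
proof -
  interpret conditioned_pair M X Y \<kappa>
    using assms by (simp add: conditioned_pair_def conditioned_pair_axioms_def)
  interpret G: prob_space G unfolding G by (rule prob_space_distr) measurable
  have F_T: "F \<in> long_tailed" "F \<in> positively_decreasing"
    using \<open>F \<in> class_T\<close> by (auto simp: class_T_def)
  have "AE y in G. y \<in> distr_support G"
    by (rule AE_distr_support[OF G.finite_measure_axioms]) (simp add: G)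
  then have AE_support: "AE \<omega> in M. Y \<omega> \<in> distr_support G"
    unfolding G by (rule AE_distrD[OF Y])
  have Y_nonneg: "AE \<omega> in M. 0 \<le> Y \<omega>"
    using AE_nonneg_of_cdf_at_left_0[OF Y] assms(8) G by simp
  have support_nonneg: "0 \<le> y" if y: "y \<in> distr_support G" for y
  proof (rule ccontr)
    assume "\<not> 0 \<le> y"
    then have "measure G {..<0} > 0" using y by (auto simp: distr_support_def)
    moreover have "measure G {..<0} = prob {\<omega>\<in>space M. Y \<omega> < 0}"
      by (auto simp: G measure_distr intro!: arg_cong[where f=prob])
    moreover have "prob {\<omega>\<in>space M. Y \<omega> < 0} = 0"
      using Y_nonneg by (subst prob_eq_0) (auto simp: not_less)
    ultimately show False by simp
  qed
  obtain h where h: "\<And>y. y \<ge> 0 \<Longrightarrow> h y > 0"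
    and unif: "uniform_limit (distr_support G)
          (\<lambda>x y. measure (\<kappa> y) {x<..} / (h y * tail F x)) (\<lambda>y. 1) at_top"
    using B by blast
  interpret conditionally_comparable_pair M X Y \<kappa> "distr_support G"
  proof
    show "prob {\<omega>\<in>space M. 0 < Y \<omega>} > 0"
      using tail_distr[OF Y, of 0] \<open>cdf G 0 < 1\<close> by (simp add: tail_def G)
    fix \<eta> :: real assume "\<eta> > 1"
    show "\<exists>s\<^sub>0. \<forall>y\<in>distr_support G. \<forall>s\<ge>s\<^sub>0. measure (\<kappa> y) {s<..} > 0 \<and>
      (\<forall>t\<ge>s\<^sub>0. measure (\<kappa> y) {s<..} * tail (distr M borel X) t
        \<le> \<eta> * measure (\<kappa> y) {t<..} * tail (distr M borel X) s)"
      using unif h support_nonneg F_T \<open>\<eta> > 1\<close> unfolding F[symmetric]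
      by (intro tail_comparison_of_uniform_equivalence) (auto simp: positively_decreasing_def)
  qed (use AE_support support_nonneg F_T F in auto)
  have "(\<lambda>x. tail (distr M borel Y) (c * x)) \<in> o[at_top](tail (distr M borel (\<lambda>\<omega>. X \<omega> * Y \<omega>)))"
    if "c > 0" for c
    using A that by (simp add: G H)
  then show ?thesis
    using product_long_tailed product_positively_decreasing F_T by (simp add: class_T_def F H)
qed

end
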